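(* Let $t\ge 2$ be an integer and let $\beta>1$ be a root of $x^{3}-2tx^{2}+2tx-t$. Then $\beta$ has property (F$_1$) but does not have property (PF).
   Context: For a real number $\beta>1$, let $T:[0,1]\to[0,1)$, $T(x)=\beta x-\lfloor \beta x\rfloor$. For $x\in[0,1]$ put $d_\beta(x)=c_1c_2\cdots$ with $c_n=\lfloor \beta T^{n-1}(x)\rfloor$, so that $x=\sum_{n\ge1}c_n\beta^{-n}$. For $x\ge 0$ let $L(x)=\min\{n\in\mathbb{N}_0: x\beta^{-n}<1\}$. A number $x\ge0$ has a finite beta-expansion if $d_\beta(\beta^{-L(x)}x)$ has only finitely many nonzero digits; $\mathrm{Fin}(\beta)$ denotes the set of such $x\ge 0$. Property (F$_1$): $\mathbb{N}_0\subset \mathrm{Fin}(\beta)$. Property (PF): $\mathbb{N}_0[1/\beta]\subset\mathrm{Fin}(\beta)$, where $\mathbb{N}_0[1/\beta]$ is the set of polynomial expressions in $1/\beta$ with nonnegative integer coefficients. *)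

theory Defs
  imports Complex_Main "HOL-Computational_Algebra.Polynomial"
begin

definition beta_T :: "real \<Rightarrow> real \<Rightarrow> real" where
  "beta_T \<beta> x = \<beta> * x - of_int \<lfloor>\<beta> * x\<rfloor>"

text \<open>Digits are indexed from \<open>n = 1\<close>; the value at \<open>n = 0\<close> carries no meaning.
  Only arguments \<open>x\<close> in \<open>[0, 1]\<close> are intended.\<close>

definition beta_digit :: "real \<Rightarrow> real \<Rightarrow> nat \<Rightarrow> int" where
  "beta_digit \<beta> x n = \<lfloor>\<beta> * (beta_T \<beta> ^^ (n - 1)) x\<rfloor>"

definition beta_L :: "real \<Rightarrow> real \<Rightarrow> nat" where
  "beta_L \<beta> x = (LEAST n. x / \<beta> ^ n < 1)"

definition beta_Fin :: "real \<Rightarrow> real set" where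
  "beta_Fin \<beta> =
     {x. 0 \<le> x \<and> finite {n. 1 \<le> n \<and> beta_digit \<beta> (x / \<beta> ^ beta_L \<beta> x) n \<noteq> 0}}"

definition property_F1 :: "real \<Rightarrow> bool" where
  "property_F1 \<beta> \<longleftrightarrow> (\<nat> :: real set) \<subseteq> beta_Fin \<beta>"

definition nat_poly_inverse :: "real \<Rightarrow> real set" where
  "nat_poly_inverse \<beta> = {poly (map_poly of_nat p) (1 / \<beta>) | p :: nat poly. True}"

definition property_PF :: "real \<Rightarrow> bool" where
  "property_PF \<beta> \<longleftrightarrow> nat_poly_inverse \<beta> \<subseteq> beta_Fin \<beta>"

end

(*
  With r1 = t / beta and r2 = beta - 2 t, every element of Z[beta] in [0, 1) is the fractional part
  of a r1 + b r2 for integers a, b, and T acts on these coordinates as the shift radix system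
  tau (a, b) = (b, - floor (a r1 + b r2)).  Brunotte's witness sets, which do not depend on t, show
  that every tau-orbit ends in one of the fixed points (0, 0) and (1, 1).  The point (1, 1) has no
  other preimage, so an expansion of an element of Z[1/beta] is infinite exactly if its orbit enters
  Z[beta] at y = 1 + r1 + r2 = (t - 1) / (beta - 1), whose digits are all t - 1.

  PF fails because y itself is a polynomial in 1/beta with nonnegative coefficients.
  For F1, let n = b + y where b has the integer digits c_{L-1}, ..., c_0 in base beta.  At a complex
  conjugate of beta (of squared modulus r1 < 5/7) this gives a bound on n that forces L <= 3.
  But then the first coordinate of the state after L steps is 0 or minus a digit, never 1.
*)
theory Submission
  imports Defs "HOL-Library.Product_Plus"
begin

locale cubic_base =
  fixes t :: int and \<beta> :: real
  assumes t_ge2: "t \<ge> 2"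
    and base_gt1: "\<beta> > 1"
    and base_root: "\<beta> ^ 3 - 2 * of_int t * \<beta> ^ 2 + 2 * of_int t * \<beta> - of_int t = 0"
begin

section \<open>The cubic, its quadratic cofactor and bounds on the base\<close>

text \<open>The cubic factors as (x - \<beta>) (x^2 + \<open>r2\<close> x +
  \<open>r1\<close>).\<close>

definition r1 :: real where "r1 = of_int t / \<beta>"
definition r2 :: real where "r2 = \<beta> - 2 * of_int t"

lemma base_mult_r1: "\<beta> * r1 = of_int t"
  using base_gt1 by (simp add: r1_def)

lemma base_mult_r2: "\<beta> * r2 = r1 - 2 * of_int t"
proof -
  have "\<beta> * (\<beta> * r2) = \<beta> * (r1 - 2 * of_int t)"
    using base_root base_mult_r1
    by (simp add: r2_def algebra_simps power2_eq_square power3_eq_cube)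
  then show ?thesis using base_gt1 by simp
qed

text \<open>Since \<open>t = \<beta> ^ 3 / dd\<close>, multiplying by \<open>dd\<close> turns linear inequalities in \<open>r1\<close> and \<open>r2\<close>
  into quadratic ones in \<open>\<beta>\<close> that are free of \<open>t\<close>.\<close>

definition dd :: real where "dd = 2 * \<beta>\<^sup>2 - 2 * \<beta> + 1"

lemma dd_pos: "dd > 0"
proof -
  have "dd = \<beta>\<^sup>2 + (\<beta> - 1)\<^sup>2" by (simp add: dd_def power2_eq_square algebra_simps)
  then show ?thesis using base_gt1 by (simp add: add_pos_nonneg)
qed

lemma t_mult_dd: "of_int t * dd = \<beta> ^ 3"
  using base_root by (simp add: dd_def algebra_simps)

lemma r1_mult_dd: "r1 * dd = \<beta>\<^sup>2"
  using t_mult_dd base_gt1 by (simp add: r1_def field_simps power2_eq_square power3_eq_cube)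

lemma r2_mult_dd: "r2 * dd = \<beta> - 2 * \<beta>\<^sup>2"
proof -
  have "r2 * dd = \<beta> * dd - 2 * (of_int t * dd)" by (simp add: r2_def algebra_simps)
  then show ?thesis
    unfolding t_mult_dd by (simp add: dd_def algebra_simps power2_eq_square power3_eq_cube)
qed

text \<open>For t \<ge> 2, \<open>t_mult_dd\<close> gives \<beta> (\<beta> - 2)^2 \<ge> 2, which
  fails on (1, 14/5]. The constant lies just below the root for t = 2, about 2.839.\<close>

lemma base_gt: "\<beta> > 14 / 5"
proof (rule ccontr)
  assume "\<not> \<beta> > 14 / 5"
  then have le: "\<beta> \<le> 14 / 5" by simp
  have "2 * dd \<le> \<beta> ^ 3"
    unfolding t_mult_dd[symmetric] using t_ge2 dd_pos by (intro mult_right_mono) auto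
  then have ge: "\<beta> * (\<beta> - 2)\<^sup>2 \<ge> 2"
    by (simp add: dd_def algebra_simps power2_eq_square power3_eq_cube)
  have "\<beta> * (\<beta> - 2)\<^sup>2 < 2"
  proof (cases "\<beta> < 2")
    case True
    then have "(\<beta> - 2)\<^sup>2 < 1" using base_gt1 by (simp add: abs_square_less_1)
    then have "\<beta> * (\<beta> - 2)\<^sup>2 < \<beta> * 1" using base_gt1 by (intro mult_strict_left_mono) auto
    then show ?thesis using True by simp
  next
    case False
    then have "(\<beta> - 2)\<^sup>2 \<le> (4/5)\<^sup>2" using le by (intro power_mono) auto
    then have "\<beta> * (\<beta> - 2)\<^sup>2 \<le> (14/5) * (4/5)\<^sup>2" using base_gt1 le by (intro mult_mono) auto
    then show ?thesis by (simp add: power2_eq_square)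
  qed
  with ge show False by simp
qed

lemma base_sq_gt: "\<beta>\<^sup>2 > 14 / 5 * \<beta>"
  using mult_strict_right_mono[OF base_gt, of \<beta>] base_gt1 by (simp add: power2_eq_square)

lemma pos_iff_dd: "0 < x \<longleftrightarrow> 0 < x * dd"
  using dd_pos by (simp add: zero_less_mult_iff)

lemma r_bounds:
  shows "r1 < 5/7" "2 * r1 + 3 * r2 < -2" "3 * r1 + r2 < 1"
    and "r1 + r2 > -1/2" "r1 > 1/2" "r2 < -1" "3 * r1 + 3 * r2 < -1" "r1 + 3 * r2 > -3"
proof -
  note e = r1_mult_dd r2_mult_dd
  have "0 < (5/7 - r1) * dd" "0 < (-2 - (2 * r1 + 3 * r2)) * dd" "0 < (1 - (3 * r1 + r2)) * dd"
    "0 < (r1 + r2 + 1/2) * dd" "0 < (r1 - 1/2) * dd" "0 < (-1 - r2) * dd"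
    "0 < (-1 - (3 * r1 + 3 * r2)) * dd" "0 < (r1 + 3 * r2 + 3) * dd"
    using base_gt base_sq_gt zero_le_power2[of "\<beta> - 14/5"]
    by (simp_all only: ring_distribs left_diff_distrib mult.assoc e)
      (simp_all add: dd_def power2_diff field_simps)
  then show "r1 < 5/7" "2 * r1 + 3 * r2 < -2" "3 * r1 + r2 < 1"
    "r1 + r2 > -1/2" "r1 > 1/2" "r2 < -1" "3 * r1 + 3 * r2 < -1" "r1 + 3 * r2 > -3"
    unfolding pos_iff_dd[symmetric] by linarith+
qed

lemma base_gt_t: "\<beta> > 7/5 * of_int t"
  using r_bounds(1) base_gt1 by (simp add: r1_def field_simps)

text \<open>Caps all digits at 2t - 2. It holds because the difference of the two sides, times
  \<open>dd\<close>, is \<beta> - 1.\<close>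

lemma base_less: "\<beta> < 2 * of_int t - 1"
proof -
  have "(2 * of_int t - 1 - \<beta>) * dd = 2 * (of_int t * dd) - (1 + \<beta>) * dd"
    by (simp add: algebra_simps)
  also have "\<dots> = \<beta> - 1"
    unfolding t_mult_dd by (simp add: dd_def algebra_simps power2_eq_square power3_eq_cube)
  finally have "0 < (2 * of_int t - 1 - \<beta>) * dd" using base_gt1 by simp
  then show ?thesis unfolding pos_iff_dd[symmetric] by simp
qed

section \<open>The shift radix system and its witness set\<close>

definition tau :: "int \<times> int \<Rightarrow> int \<times> int" where
  "tau z = (snd z, - \<lfloor>of_int (fst z) * r1 + of_int (snd z) * r2\<rfloor>)"

definition coord :: "int \<times> int \<Rightarrow> real" where
  "coord z = frac (of_int (fst z) * r1 + of_int (snd z) * r2)"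

lemma beta_T_eq_frac: "beta_T \<beta> x = frac (\<beta> * x)"
  by (simp add: beta_T_def frac_def)

text \<open>Modulo integers, multiplication by \<beta> sends \<open>r1\<close>, \<open>r2\<close>, 1
  to 0, \<open>r1\<close>, \<open>r2\<close>. So the coordinates shift, and the integer that
  \<open>frac\<close> adds becomes the new second coordinate.\<close>

lemma beta_T_coord: "beta_T \<beta> (coord z) = coord (tau z)"
proof -
  obtain a b where z: "z = (a, b)" by (cases z)
  define c where "c = - \<lfloor>of_int a * r1 + of_int b * r2\<rfloor>"
  have "\<beta> * coord z = of_int a * (\<beta> * r1) + of_int b * (\<beta> * r2) + of_int c * \<beta>"
    by (simp add: coord_def z frac_def c_def algebra_simps)
  also have "\<dots> = (of_int b * r1 + of_int c * r2) + of_int (a * t - 2 * b * t + 2 * c * t)"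
    unfolding base_mult_r1 base_mult_r2 by (simp add: r2_def algebra_simps)
  finally show ?thesis
    unfolding beta_T_eq_frac by (simp add: coord_def tau_def z c_def frac_def)
qed

lemma funpow_beta_T_coord: "(beta_T \<beta> ^^ k) (coord z) = coord ((tau ^^ k) z)"
  by (induction k) (simp_all add: beta_T_coord)

text \<open>A preimage is (a, 1) with a \<open>r1\<close> + \<open>r2\<close> in [-1, 0). Since
  \<open>r2\<close> < -1 and 2 \<open>r1\<close> + \<open>r2\<close> > 0, only a = 1 is
  left.\<close>

lemma tau_eq_11_imp: assumes "tau z = (1, 1)" shows "z = (1, 1)"
proof -
  obtain a b where z: "z = (a, b)" by (cases z)
  have b: "b = 1" and "\<lfloor>of_int a * r1 + r2\<rfloor> = -1" using assms by (auto simp: tau_def z)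
  then have fl: "-1 \<le> of_int a * r1 + r2" "of_int a * r1 + r2 < 0"
    by (auto simp: floor_eq_iff)
  have "a < 2"
  proof (rule ccontr)
    assume "\<not> a < 2"
    then have "2 * r1 \<le> of_int a * r1" using r_bounds by (intro mult_right_mono) auto
    then show False using fl r_bounds by linarith
  qed
  moreover have "a > 0"
  proof (rule ccontr)
    assume "\<not> a > 0"
    then have "of_int a * r1 \<le> 0 * r1" using r_bounds by (intro mult_right_mono) auto
    then show False using fl r_bounds by simp
  qed
  ultimately show ?thesis by (simp add: z b)
qed

lemma funpow_tau_eq_11_imp: "(tau ^^ k) z = (1, 1) \<Longrightarrow> z = (1, 1)"
  by (induction k) (auto dest: tau_eq_11_imp)

text \<open>For small arguments the perturbations \<open>r1 - 1/2\<close> and \<open>r2 + 1\<close> of the limit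
  values for large \<open>t\<close> only decide ties.\<close>

lemma tau_small:
  assumes "a \<in> {-3..4}" "b \<in> {-3..4}" "\<bar>a - b\<bar> \<le> 2"
  shows "tau (a, b) = (b, b - (a - (if a < b \<or> a = b \<and> a < 0 then 1 else 0)) div 2)"
proof -
  have a: "a = -3 \<or> a = -2 \<or> a = -1 \<or> a = 0 \<or> a = 1 \<or> a = 2 \<or> a = 3 \<or> a = 4"
    using assms(1) by auto
  have b: "b = a - 2 \<or> b = a - 1 \<or> b = a \<or> b = a + 1 \<or> b = a + 2"
    using assms(3) by auto
  have "\<lfloor>of_int a * r1 + of_int b * r2\<rfloor>
      = (a - (if a < b \<or> a = b \<and> a < 0 then 1 else 0)) div 2 - b"
    unfolding floor_eq_iff using a b assms(2) r_bounds
    by (elim disjE; simp; linarith)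
  then show ?thesis by (simp add: tau_def)
qed

text \<open>A witness set: it contains the unit vectors, and by subadditivity of the floor the
  difference of two orbits never leaves it.\<close>

definition wit :: "(int \<times> int) set" where
  "wit = {(a, b). \<bar>a\<bar> \<le> 3 \<and> \<bar>b\<bar> \<le> 3 \<and> \<bar>a - b\<bar> \<le> 2}"

text \<open>An integer \<open>-c\<close> within these limits satisfies |c| \<le> 3 and |b - c| \<le>
  2, so that \<open>(b, c)\<close> is again in \<open>wit\<close>.\<close>

lemma wit_bounds:
  assumes "(a, b) \<in> wit"
  shows "max (-3) (-2 - of_int b) \<le> of_int a * r1 + of_int b * r2"
    and "of_int a * r1 + of_int b * r2 \<le> min 3 (2 - of_int b)"
proof -
  have a: "a = -3 \<or> a = -2 \<or> a = -1 \<or> a = 0 \<or> a = 1 \<or> a = 2 \<or> a = 3"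
    and b: "b = a - 2 \<or> b = a - 1 \<or> b = a \<or> b = a + 1 \<or> b = a + 2" and b3: "\<bar>b\<bar> \<le> 3"
    using assms by (auto simp: wit_def)
  show "max (-3) (-2 - of_int b) \<le> of_int a * r1 + of_int b * r2"
    using a b b3 r_bounds by (elim disjE; simp; linarith)
  show "of_int a * r1 + of_int b * r2 \<le> min 3 (2 - of_int b)"
    using a b b3 r_bounds by (elim disjE; simp; linarith)
qed

lemma tau_add_wit:
  assumes "v \<in> wit" shows "\<exists>w\<in>wit. tau (x + v) = tau x + w"
proof -
  obtain a b where v: "v = (a, b)" by (cases v)
  define A where "A = of_int (fst x) * r1 + of_int (snd x) * r2"
  define B where "B = of_int a * r1 + of_int b * r2"
  define c where "c = \<lfloor>A\<rfloor> - \<lfloor>A + B\<rfloor>"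
  have B: "of_int \<lfloor>A + B\<rfloor> - of_int \<lfloor>A\<rfloor> < B + 1" "B - 1 < of_int \<lfloor>A + B\<rfloor> - of_int \<lfloor>A\<rfloor>"
    by linarith+
  \<comment> \<open>\<open>-c\<close> differs from \<open>B\<close> by less than 1 and the limits
    for \<open>B\<close> are integers, so \<open>-c\<close> obeys the same limits.\<close>
  have "real_of_int (- c) < of_int (min 3 (2 - b)) + 1" "of_int (max (-3) (-2 - b)) - 1 < real_of_int (- c)"
    using B wit_bounds[of a b] assms unfolding c_def v B_def[symmetric] by auto
  then have "- c \<le> min 3 (2 - b)" "max (-3) (-2 - b) \<le> - c" by linarith+
  then have "(b, c) \<in> wit" using assms by (auto simp: wit_def v)
  moreover have "tau (x + v) = tau x + (b, c)"
    by (simp add: tau_def v c_def A_def B_def algebra_simps)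
  ultimately show ?thesis by blast
qed

lemma funpow_tau_add_wit:
  assumes "v \<in> wit" shows "\<exists>w\<in>wit. (tau ^^ k) (x + v) = (tau ^^ k) x + w"
proof (induction k)
  case 0
  then show ?case using assms by auto
next
  case (Suc k)
  then obtain w where "w \<in> wit" "(tau ^^ k) (x + v) = (tau ^^ k) x + w" by blast
  then show ?case using tau_add_wit[of w "(tau ^^ k) x"] by simp
qed

section \<open>Convergence of every orbit to a fixed point\<close>

definition attracted :: "int \<times> int \<Rightarrow> bool" where
  "attracted z \<longleftrightarrow> (\<exists>k. (tau ^^ k) z \<in> {(0, 0), (1, 1)})"

lemma attracted_funpow: "attracted ((tau ^^ k) z) \<Longrightarrow> attracted z"
  unfolding attracted_def by (metis funpow_add comp_apply)

text \<open>The region contains \<open>wit\<close> and its translate by (1, 1), hence the upper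
  limit 4.\<close>

lemma attracted_small:
  assumes "a \<in> {-3..4}" "b \<in> {-3..4}" "\<bar>a - b\<bar> \<le> 2"
  shows "attracted (a, b)"
proof -
  have a: "a = -3 \<or> a = -2 \<or> a = -1 \<or> a = 0 \<or> a = 1 \<or> a = 2 \<or> a = 3 \<or> a = 4"
    using assms(1) by auto
  have b: "b = a - 2 \<or> b = a - 1 \<or> b = a \<or> b = a + 1 \<or> b = a + 2"
    using assms(3) by auto
  \<comment> \<open>Twelve steps suffice for every starting point in the region.\<close>
  have "(tau ^^ 12) (a, b) \<in> {(0, 0), (1, 1)}"
    using a b assms(2) by (elim disjE; simp add: tau_small eval_nat_numeral)
  then show ?thesis unfolding attracted_def by blast
qed

text \<open>Once the orbit of \<open>x\<close> has reached a fixed point, the perturbed orbit is off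
  by an element of \<open>wit\<close>, and \<open>attracted_small\<close> applies.\<close>

lemma attracted_add_wit:
  assumes "attracted x" "v \<in> wit" shows "attracted (x + v)"
proof -
  obtain k where k: "(tau ^^ k) x \<in> {(0, 0), (1, 1)}" using assms(1) by (auto simp: attracted_def)
  obtain w where w: "w \<in> wit" "(tau ^^ k) (x + v) = (tau ^^ k) x + w"
    using funpow_tau_add_wit[OF assms(2)] by blast
  have "attracted ((tau ^^ k) x + w)"
    using k w(1) by (cases w) (auto simp: wit_def abs_le_iff intro!: attracted_small)
  then show ?thesis using attracted_funpow[of k "x + v"] w(2) by simp
qed

text \<open>As \<open>wit\<close> contains the unit vectors and their negatives, attraction spreads
  from the origin over the whole lattice.\<close>

lemma attracted_all: "attracted z"
proof -
  obtain a b where z: "z = (a, b)" by (cases z)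
  have step: "attracted ((a, b) + v)" if "attracted (a, b)" "v \<in> {(1,0), (-1,0), (0,1), (0,-1)}" for a b v
    using that by (intro attracted_add_wit) (auto simp: wit_def)
  have "attracted (a, 0)"
  proof (induction a rule: int_induct[where k = 0])
    case base
    show ?case by (rule attracted_small) auto
  next
    case (step1 i)
    then show ?case using step[of i 0 "(1, 0)"] by simp
  next
    case (step2 i)
    then show ?case using step[of i 0 "(-1, 0)"] by simp
  qed
  then have "attracted (a, b)"
  proof (induction b rule: int_induct[where k = 0])
    case (step1 i)
    then show ?case using step[of a i "(0, 1)"] by simp
  next
    case (step2 i)
    then show ?case using step[of a i "(0, -1)"] by simp
  qed
  then show ?thesis by (simp add: z)
qed

lemma coord_tail:
  assumes "z \<noteq> (1, 1)"
  shows "\<exists>k. (beta_T \<beta> ^^ k) (coord z) = 0"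
proof -
  obtain k where "(tau ^^ k) z \<in> {(0, 0), (1, 1)}"
    using attracted_all[of z] unfolding attracted_def by blast
  then have "(tau ^^ k) z = (0, 0)" using funpow_tau_eq_11_imp assms by blast
  moreover have "coord (0, 0) = 0" by (simp add: coord_def)
  ultimately show ?thesis by (metis funpow_beta_T_coord)
qed

lemma coord_11: "coord (1, 1) = 1 + r1 + r2"
proof -
  have "\<lfloor>r1 + r2\<rfloor> = -1" using r_bounds by (simp add: floor_eq_iff)
  then show ?thesis by (simp add: coord_def frac_def)
qed

section \<open>The complex conjugate and the integer parts of orbits\<close>

text \<open>\<gamma> is a nonreal root of the cofactor x^2 + \<open>r2\<close> x +
  \<open>r1\<close>, so its squared modulus is the product \<open>r1\<close> of the two roots. The
  last equation is \<open>base_mult_r2\<close> with \<gamma> in place of \<beta>.\<close>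

lemma conjugate_root:
  obtains \<gamma> :: complex where "norm \<gamma> ^ 2 = r1" "\<gamma> \<noteq> 0"
    "\<gamma> * (\<gamma> - 2 * of_int t) = of_int t / \<gamma> - 2 * of_int t"
proof -
  define \<gamma> where "\<gamma> = Complex (- r2 / 2) (sqrt (r1 - (r2 / 2)\<^sup>2))"
  have "\<bar>r2\<bar>\<^sup>2 \<le> (5/4)\<^sup>2" using r_bounds by (intro power_mono) auto
  then have "r1 - (r2 / 2)\<^sup>2 \<ge> 0" using r_bounds by (simp add: power_divide)
  then have sq: "(sqrt (r1 - (r2 / 2)\<^sup>2))\<^sup>2 = r1 - (r2 / 2)\<^sup>2" by simp
  have nrm: "norm \<gamma> ^ 2 = r1" 
    unfolding \<gamma>_def cmod_power2 complex.sel sq by (simp add: power_divide)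
  then have nz: "\<gamma> \<noteq> 0" using r_bounds by auto
  have quad: "\<gamma>\<^sup>2 + of_real r2 * \<gamma> + of_real r1 = 0"
    using sq by (simp add: complex_eq_iff \<gamma>_def power2_eq_square)
  have b0: "of_real \<beta> * of_real r1 = (of_int t :: complex)"
    "of_real \<beta> * of_real r2 = of_real r1 - (2 * of_int t :: complex)"
    unfolding of_real_mult[symmetric] base_mult_r1 base_mult_r2 by simp_all
  have b1: "of_real r2 = of_real \<beta> - (2 * of_int t :: complex)" by (simp add: r2_def)
  have "(\<gamma>\<^sup>2 + of_real r2 * \<gamma> + of_real r1) * (\<gamma> - of_real \<beta>)
      = \<gamma> ^ 3 + (of_real r2 - of_real \<beta>) * \<gamma>\<^sup>2 + (of_real r1 - of_real \<beta> * of_real r2) * \<gamma>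
        - of_real \<beta> * of_real r1"
    by (simp add: algebra_simps power2_eq_square power3_eq_cube)
  also have "\<dots> = \<gamma> ^ 3 - 2 * of_int t * \<gamma>\<^sup>2 + 2 * of_int t * \<gamma> - of_int t"
    unfolding b0 by (simp add: b1)
  finally have "\<gamma> * (\<gamma> - 2 * of_int t) = of_int t / \<gamma> - 2 * of_int t"
    using nz unfolding quad by (simp add: field_simps power2_eq_square power3_eq_cube)
  with nrm nz show thesis by (rule that)
qed

text \<open>The coordinates of minus the integer part produced by the first \<open>k\<close> digits. The norm is
  that of its image under the conjugation \<open>\<beta> \<mapsto> \<gamma>\<close>; the signs are those of the
  leading digits.\<close>

lemma orbit_state:
  fixes x :: real and \<gamma> :: complex
  assumes x: "0 \<le> x" "x < 1"
    and \<gamma>: "norm \<gamma> < 1" "\<gamma> \<noteq> 0" "\<gamma> * (\<gamma> - 2 * of_int t) = of_int t / \<gamma> - 2 * of_int t"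
  shows "\<exists>a b c :: int. (beta_T \<beta> ^^ k) x = \<beta> ^ k * x + of_int a * r1 + of_int b * r2 + of_int c
    \<and> (1 - norm \<gamma>) * norm (of_int a * (of_int t / \<gamma>) + of_int b * (\<gamma> - 2 * of_int t) + of_int c)
        \<le> 2 * of_int t - 2
    \<and> (k \<le> 3 \<longrightarrow> a \<le> 0) \<and> (k \<le> 2 \<longrightarrow> b \<le> 0) \<and> (k \<le> 1 \<longrightarrow> c \<le> 0)
    \<and> (k = 0 \<longrightarrow> a = 0 \<and> b = 0 \<and> c = 0)"
proof (induction k)
  case 0
  show ?case using t_ge2 by (intro exI[of _ 0]) auto
next
  case (Suc k)
  define y where "y = (beta_T \<beta> ^^ k) x"
  obtain a b c where y_eq: "y = \<beta> ^ k * x + of_int a * r1 + of_int b * r2 + of_int c"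
    and bd: "(1 - norm \<gamma>) * norm (of_int a * (of_int t / \<gamma>) + of_int b * (\<gamma> - 2 * of_int t) + of_int c)
        \<le> 2 * of_int t - 2"
    and sg: "k \<le> 3 \<longrightarrow> a \<le> 0" "k \<le> 2 \<longrightarrow> b \<le> 0" "k \<le> 1 \<longrightarrow> c \<le> 0"
      "k = 0 \<longrightarrow> a = 0 \<and> b = 0 \<and> c = 0"
    using Suc.IH unfolding y_def by blast
  define P where "P = of_int a * (of_int t / \<gamma>) + of_int b * (\<gamma> - 2 * of_int t) + of_int c"
  define d where "d = \<lfloor>\<beta> * y\<rfloor>"
  define c' where "c' = a * t - 2 * b * t + 2 * c * t - d"
  have y01: "0 \<le> y" "y < 1"
    unfolding y_def using x by (cases k; simp add: beta_T_eq_frac frac_lt_1)+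
  have "\<beta> * y \<le> \<beta>" using y01 base_gt1 by simp
  then have "real_of_int d < 2 * of_int t - 1" unfolding d_def using base_less by linarith
  then have d: "0 \<le> d" "d \<le> 2 * t - 2" using y01 base_gt1 by (auto simp: d_def)
  have "beta_T \<beta> y = \<beta> ^ Suc k * x + of_int a * (\<beta> * r1) + of_int b * (\<beta> * r2) + of_int c * \<beta> - of_int d"
    unfolding beta_T_def d_def[symmetric] by (simp add: y_eq algebra_simps)
  also have "\<dots> = \<beta> ^ Suc k * x + of_int b * r1 + of_int c * r2 + of_int c'"
    unfolding base_mult_r1 base_mult_r2 by (simp add: c'_def r2_def algebra_simps)
  finally have 1: "(beta_T \<beta> ^^ Suc k) x = \<beta> ^ Suc k * x + of_int b * r1 + of_int c * r2 + of_int c'"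
    by (simp add: y_def)
  have "of_int b * (of_int t / \<gamma>) + of_int c * (\<gamma> - 2 * of_int t) + of_int c'
      = of_int a * of_int t + of_int b * (\<gamma> * (\<gamma> - 2 * of_int t)) + of_int c * \<gamma> - of_int d"
    unfolding \<gamma>(3) by (simp add: c'_def algebra_simps)
  also have "\<dots> = \<gamma> * P - of_int d" using \<gamma>(2) by (simp add: P_def algebra_simps)
  finally have P': "of_int b * (of_int t / \<gamma>) + of_int c * (\<gamma> - 2 * of_int t) + of_int c' = \<gamma> * P - of_int d" .
  have "norm (\<gamma> * P - of_int d) \<le> norm \<gamma> * norm P + of_int d"
    using norm_triangle_ineq4[of "\<gamma> * P" "of_int d"] d by (simp add: norm_mult)
  then have "(1 - norm \<gamma>) * norm (\<gamma> * P - of_int d) \<le> (1 - norm \<gamma>) * (norm \<gamma> * norm P + of_int d)"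
    using \<gamma> by (intro mult_left_mono) auto
  also have "\<dots> = norm \<gamma> * ((1 - norm \<gamma>) * norm P) + (1 - norm \<gamma>) * of_int d"
    by (simp add: algebra_simps)
  \<comment> \<open>Geometric series: the bound (2t - 2) / (1 - |\<gamma>|) is invariant under
    multiplication by |\<gamma>| followed by adding a digit, which is at most 2t - 2.\<close>
  also have "\<dots> \<le> norm \<gamma> * (2 * of_int t - 2) + (1 - norm \<gamma>) * (2 * of_int t - 2)"
    using bd d \<gamma> unfolding P_def[symmetric] by (intro add_mono mult_left_mono) auto
  also have "\<dots> = 2 * of_int t - 2" by (simp add: algebra_simps)
  finally have 2: "(1 - norm \<gamma>) * norm (of_int b * (of_int t / \<gamma>) + of_int c * (\<gamma> - 2 * of_int t) + of_int c')
      \<le> 2 * of_int t - 2" unfolding P' .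
  \<comment> \<open>For k = 0 the old coordinates vanish and \<open>c'\<close> is minus the first
    digit. The other signs shift along with the coordinates.\<close>
  have "Suc k \<le> 1 \<longrightarrow> c' \<le> 0" using sg d by (auto simp: c'_def)
  then show ?case using sg by (intro exI[of _ b] exI[of _ c] exI[of _ c'] conjI 1 2) auto
qed

section \<open>Finite expansions of the natural numbers\<close>

lemma beta_Fin_if_zero:
  assumes "0 \<le> x" "(beta_T \<beta> ^^ K) (x / \<beta> ^ beta_L \<beta> x) = 0"
  shows "x \<in> beta_Fin \<beta>"
proof -
  have "beta_T \<beta> 0 = 0" by (simp add: beta_T_def)
  then have "(beta_T \<beta> ^^ (j + K)) (x / \<beta> ^ beta_L \<beta> x) = 0" for j
    by (induction j) (simp_all add: assms(2))
  then have z: "(beta_T \<beta> ^^ m) (x / \<beta> ^ beta_L \<beta> x) = 0" if "K \<le> m" for m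
    using that by (metis le_add_diff_inverse2)
  have "n \<le> K" if "1 \<le> n" "beta_digit \<beta> (x / \<beta> ^ beta_L \<beta> x) n \<noteq> 0" for n
    using that z[of "n - 1"] by (cases "K \<le> n - 1") (auto simp: beta_digit_def)
  then have "{n. 1 \<le> n \<and> beta_digit \<beta> (x / \<beta> ^ beta_L \<beta> x) n \<noteq> 0} \<subseteq> {..K}" by auto
  then show ?thesis using assms(1) finite_subset by (auto simp: beta_Fin_def)
qed

lemma nat_in_beta_Fin: "real n \<in> beta_Fin \<beta>"
proof -
  define L where "L = beta_L \<beta> (real n)"
  define x where "x = real n / \<beta> ^ L"
  have ex: "\<exists>m. real n / \<beta> ^ m < 1"
    using real_arch_pow[OF base_gt1, of "real n"] base_gt1 by (auto simp: field_simps)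
  then have x: "0 \<le> x" "x < 1"
    using LeastI_ex[OF ex] base_gt1 by (simp_all add: x_def L_def beta_L_def)
  obtain \<gamma> :: complex where \<gamma>: "norm \<gamma> ^ 2 = r1" "\<gamma> \<noteq> 0"
    "\<gamma> * (\<gamma> - 2 * of_int t) = of_int t / \<gamma> - 2 * of_int t" by (rule conjugate_root)
  \<comment> \<open>423/500 is slightly above the square root of 5/7 and leaves 1 - |\<gamma>| >
    77/500.\<close>
  have q: "norm \<gamma> < 423/500"
    by (rule power2_less_imp_less) (use \<gamma>(1) r_bounds in \<open>auto simp: power_divide\<close>)
  obtain a b c where y: "(beta_T \<beta> ^^ L) x = \<beta> ^ L * x + of_int a * r1 + of_int b * r2 + of_int c"
    and bd: "(1 - norm \<gamma>) * norm (of_int a * (of_int t / \<gamma>) + of_int b * (\<gamma> - 2 * of_int t) + of_int c)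
        \<le> 2 * of_int t - 2"
    and a: "L \<le> 3 \<longrightarrow> a \<le> 0"
    using orbit_state[OF x _ \<gamma>(2,3), of L] q by auto
  have "0 \<le> (beta_T \<beta> ^^ L) x" "(beta_T \<beta> ^^ L) x < 1"
    using x by (cases L; simp add: beta_T_eq_frac frac_lt_1)+
  moreover have "\<beta> ^ L * x = of_int (int n)" using base_gt1 by (simp add: x_def)
  ultimately have fl: "\<lfloor>of_int a * r1 + of_int b * r2\<rfloor> = - (c + int n)"
    unfolding y floor_eq_iff by auto
  then have yL: "(beta_T \<beta> ^^ L) x = coord (a, b)"
    unfolding y \<open>\<beta> ^ L * x = of_int (int n)\<close> by (simp add: coord_def frac_def)
  have "(a, b) \<noteq> (1, 1)"
  proof
    assume ab: "(a, b) = (1, 1)"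
    then have "L > 3" using a by auto
    then have "\<not> real n / \<beta> ^ 3 < 1"
      unfolding L_def beta_L_def by (rule not_less_Least)
    then have n_ge: "\<beta> ^ 3 \<le> real n" using base_gt1 by (simp add: field_simps)
    have "\<lfloor>r1 + r2\<rfloor> = -1" using r_bounds by (simp add: floor_eq_iff)
    then have c: "c = 1 - int n" using fl ab by simp
    \<comment> \<open>The conjugate of \<open>coord (1, 1)\<close>; \<open>Y - of_nat n\<close> is
      then minus the conjugate of the integer part.\<close>
    define Y where "Y = 1 + of_int t / \<gamma> + (\<gamma> - 2 * of_int t)"
    have "Y * (\<gamma> - 1) = of_int (t - 1)"
    proof -
      have "Y * (\<gamma> - 1) = \<gamma> * (of_int t / \<gamma>) + \<gamma> * (\<gamma> - 2 * of_int t)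
          - of_int t / \<gamma> + 2 * of_int t - 1"
        unfolding Y_def ring_distribs left_diff_distrib right_diff_distrib by (simp add: mult.commute)
      then show ?thesis unfolding \<gamma>(3) using \<gamma>(2) by simp
    qed
    then have "norm Y * norm (\<gamma> - 1) = of_int (t - 1)"
      using t_ge2 by (metis norm_mult norm_of_int abs_of_nonneg diff_ge_0_iff_ge order_trans one_le_numeral of_int_abs)
    moreover have "1 - norm \<gamma> \<le> norm (\<gamma> - 1)"
      using norm_triangle_ineq2[of 1 \<gamma>] by (simp add: norm_minus_commute)
    ultimately have Y: "(1 - norm \<gamma>) * norm Y \<le> of_int t - 1"
      using mult_left_mono[of "1 - norm \<gamma>" "norm (\<gamma> - 1)" "norm Y"] by (simp add: mult.commute)
    have Yn: "(1 - norm \<gamma>) * norm (Y - of_nat n) \<le> 2 * of_int t - 2"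
      using bd ab c by (simp add: Y_def algebra_simps)
    have "(77/500) * real n \<le> (1 - norm \<gamma>) * real n"
      using q by (intro mult_right_mono) auto
    also have "\<dots> \<le> (1 - norm \<gamma>) * (norm Y + norm (Y - of_nat n))"
      using q norm_triangle_ineq4[of Y "Y - of_nat n"] by (intro mult_left_mono) auto
    also have "\<dots> \<le> (of_int t - 1) + (2 * of_int t - 2)"
      unfolding ring_distribs(1) using Y Yn by (rule add_mono)
    finally have "77 * real n \<le> 1500 * (of_int t - 1)" by simp
    \<comment> \<open>The upper bound on n is below 19.5 (t - 1). Against it, n \<ge> \<beta>^3 >
      (7t/5)^3 \<ge> 21.9 (t - 1), by t^3 \<ge> 2 t^2 \<ge> 8 (t - 1).\<close>
    moreover have "(7/5 * of_int t) ^ 3 < \<beta> ^ 3"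
      using base_gt_t t_ge2 by (intro power_strict_mono) auto
    moreover have "(7/5 * of_int t :: real) ^ 3 \<ge> 343/125 * (8 * (of_int t - 1))"
    proof -
      have "real_of_int t * (of_int t)\<^sup>2 \<ge> 2 * (4 * (of_int t - 1))"
        using t_ge2 zero_le_power2[of "real_of_int t - 2"]
        by (intro mult_mono) (auto simp: power2_eq_square algebra_simps)
      then show ?thesis by (simp add: power2_eq_square power3_eq_cube algebra_simps)
    qed
    ultimately show False using n_ge t_ge2 by (simp add: algebra_simps)
  qed
  then obtain k where "(beta_T \<beta> ^^ k) (coord (a, b)) = 0" using coord_tail by blast
  then have "(beta_T \<beta> ^^ (k + L)) x = 0" by (simp add: funpow_add yL)
  then show ?thesis by (intro beta_Fin_if_zero) (auto simp: x_def L_def)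
qed

section \<open>A polynomial in 1/\<beta> with an infinite expansion\<close>

lemma coord_11_mult: "\<beta> * coord (1, 1) = coord (1, 1) + (of_int t - 1)"
proof -
  have "\<beta> * coord (1, 1) = \<beta> + \<beta> * r1 + \<beta> * r2" by (simp add: coord_11 algebra_simps)
  also have "\<dots> = coord (1, 1) + (of_int t - 1)"
    unfolding base_mult_r1 base_mult_r2 coord_11 by (simp add: r2_def)
  finally show ?thesis .
qed

lemma coord_11_notin_beta_Fin: "coord (1, 1) \<notin> beta_Fin \<beta>"
proof -
  have y: "0 \<le> coord (1, 1)" "coord (1, 1) < 1" by (simp_all add: coord_def frac_lt_1)
  have L: "beta_L \<beta> (coord (1, 1)) = 0"
    unfolding beta_L_def using y by (intro Least_eq_0) simp
  have fl: "\<lfloor>\<beta> * coord (1, 1)\<rfloor> = t - 1"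
    unfolding coord_11_mult using y by (simp add: floor_eq_iff)
  have "beta_T \<beta> (coord (1, 1)) = coord (1, 1)"
    unfolding beta_T_def fl unfolding coord_11_mult by simp
  then have "(beta_T \<beta> ^^ m) (coord (1, 1)) = coord (1, 1)" for m
    by (induction m) simp_all
  then have "{n. 1 \<le> n \<and> beta_digit \<beta> (coord (1, 1) / \<beta> ^ beta_L \<beta> (coord (1, 1))) n \<noteq> 0} = {1..}"
    using t_ge2 by (auto simp: beta_digit_def L fl)
  then show ?thesis by (auto simp: beta_Fin_def infinite_Ici)
qed

lemma coord_11_in_nat_poly_inverse: "coord (1, 1) \<in> nat_poly_inverse \<beta>"
proof -
  define s where "s = nat t"
  define u where "u = 1 / \<beta>"
  have s: "2 * s\<^sup>2 \<ge> 3 * s" "real s = of_int t" "s \<ge> 1" "s\<^sup>2 \<ge> s"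
    using t_ge2 by (auto simp: s_def power2_eq_square)
  have u: "\<beta> * u = 1" using base_gt1 by (simp add: u_def)
  have g: "s * u ^ 3 - 2 * s * u\<^sup>2 + 2 * s * u - 1 = 0"
  proof -
    have "\<beta> ^ 3 * (s * u ^ 3 - 2 * s * u\<^sup>2 + 2 * s * u - 1)
      = s * (\<beta> * u) ^ 3 - 2 * s * (\<beta> * u)\<^sup>2 * \<beta> + 2 * s * (\<beta> * u) * \<beta>\<^sup>2 - \<beta> ^ 3"
      by (simp add: algebra_simps power2_eq_square power3_eq_cube)
    also have "\<dots> = 0" unfolding u using base_root s(2) by (simp add: algebra_simps)
    finally show ?thesis using base_gt1 by simp
  qed
  have r1: "r1 = s * u" by (simp add: r1_def u_def s)
  have "\<beta> = \<beta> * (s * u ^ 3 - 2 * s * u\<^sup>2 + 2 * s * u)" using g by simp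
  also have "\<dots> = s * u\<^sup>2 * (\<beta> * u) - 2 * s * u * (\<beta> * u) + 2 * s * (\<beta> * u)"
    by (simp add: algebra_simps power2_eq_square power3_eq_cube)
  finally have "\<beta> = s * u\<^sup>2 - 2 * s * u + 2 * s" unfolding u by simp
  then have r2: "r2 = s * u\<^sup>2 - 2 * s * u" unfolding r2_def s(2)[symmetric] by linarith
  \<comment> \<open>In terms of u, \<open>coord (1, 1)\<close> is 1 - s u + s u^2. Adding the left
    side of \<open>g\<close> gives s u - s u^2 + s u^3, and adding s u (1 + u + u^2) (1 + u) times
    it makes all coefficients nonnegative. The natural subtractions are exact as s \<ge> 2.\<close>
  define p :: "nat poly" where
    "p = [:0, 0, 2 * s\<^sup>2 - 3 * s, 2 * s\<^sup>2 - s, s\<^sup>2 - s, 0, 0, s\<^sup>2:]"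
  have "poly (map_poly of_nat p) u
      = (2 * real s ^ 2 - 3 * s) * u\<^sup>2 + (2 * real s ^ 2 - s) * u ^ 3 + (real s ^ 2 - s) * u ^ 4
        + real s ^ 2 * u ^ 7"
    using s by (simp add: p_def map_poly_pCons of_nat_diff eval_nat_numeral algebra_simps)
  also have "\<dots> = coord (1, 1)
      + (s * u * (1 + u + u\<^sup>2) * (1 + u) + 1) * (s * u ^ 3 - 2 * s * u\<^sup>2 + 2 * s * u - 1)"
    by (simp add: coord_11 r1 r2 eval_nat_numeral algebra_simps)
  finally have "poly (map_poly of_nat p) u = coord (1, 1)" unfolding g by simp
  then show ?thesis unfolding nat_poly_inverse_def u_def by (intro CollectI exI[of _ p]) auto
qed

end

theorem theorem1p2:
  fixes t :: int and \<beta> :: real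
  assumes "t \<ge> 2"
    and "\<beta> > 1"
    and "\<beta> ^ 3 - 2 * of_int t * \<beta> ^ 2 + 2 * of_int t * \<beta> - of_int t = 0"
  shows "property_F1 \<beta> \<and> \<not> property_PF \<beta>"
proof -
  interpret cubic_base t \<beta> by unfold_locales (use assms in auto)
  have "property_F1 \<beta>"
    by (auto simp: property_F1_def Nats_def nat_in_beta_Fin)
  moreover have "\<not> property_PF \<beta>"
    unfolding property_PF_def using coord_11_in_nat_poly_inverse coord_11_notin_beta_Fin by blast
  ultimately show ?thesis by blast
qed

end
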